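(* Let $k\ge 1$, let $C\subset\mathbb{R}^n$ be a $k$-solid cone, and let $\Phi_t$ be a $C^{1,\alpha}$-smooth flow on $\mathbb{R}^n$ (for some $\alpha\in(0,1]$) that is strongly monotone with respect to $C$ and satisfies $D_x\Phi_t(C\setminus\{0\})\subset \mathrm{Int}\,C$ for all $x\in\mathbb{R}^n$ and $t>0$. Let $D\subset\mathbb{R}^n$ be an open bounded set such that the orbit set $O(D)=\bigcup_{x\in D}O(x)$ is bounded. Let $Q=\{x\in\mathbb{R}^n: O(x)\text{ is pseudo-ordered}\}$. Then the set $$\{x\in D:\ x\in Q\ \text{ or }\ \omega(x)\text{ is a singleton}\}$$ is prevalent in $D$. Furthermore, this set has full Lebesgue measure in $D$ (i.e. its complement in $D$ has Lebesgue measure zero).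
   Context: Cones. A closed set $C\subset\mathbb{R}^n$ is a $k$-cone if (i) $lv\in C$ for all $v\in C$, $l\in\mathbb{R}$; and (ii) $\max\{\dim W: W\subset C\text{ a linear subspace}\}=k$. It is a $k$-solid cone if moreover there is a $k$-dimensional linear subspace $W$ with $W\setminus\{0\}\subset\mathrm{Int}\,C$. (No convexity is assumed.) Write $x\sim y$ (ordered) if $x-y\in C$, and $x\approx y$ (strongly ordered) if $x-y\in\mathrm{Int}\,C$. Flows. A flow on $\mathbb{R}^n$ is a continuous map $\Phi:\mathbb{R}\times\mathbb{R}^n\to\mathbb{R}^n$, $\Phi_t(x)=\Phi(t,x)$, with $\Phi_0=\mathrm{id}$ and $\Phi_t\circ\Phi_s=\Phi_{t+s}$. It is $C^{1,\alpha}$-smooth if $\Phi$ is a $C^1$ map on $\mathbb{R}\times\mathbb{R}^n$ with locally $\alpha$-Hölder derivative. $D_x\Phi_t$ is the derivative of $\Phi_t$ with respect to $x$ at $(t,x)$. The flow is monotone with respect to $C$ if $x\sim y$ implies $\Phi_t(x)\sim\Phi_t(y)$ for $t\ge0$; it is strongly monotone with respect to $C$ if $x\ne y$, $x\sim y$ and $t>0$ imply $\Phi_t(x)\approx\Phi_t(y)$. Orbits. $O(x)=\{\Phi_t(x):t\ge0\}$; $\omega(x)=\bigcap_{s\ge0}\overline{\bigcup_{t\ge s}\{\Phi_t(x)\}}$. A point $x$ is an equilibrium if $O(x)=\{x\}$; an orbit is nontrivial if it is not a single point. A nontrivial orbit $O(x)$ is pseudo-ordered if it contains two distinct points $\Phi_{t_1}(x)\neq\Phi_{t_2}(x)$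 with $\Phi_{t_1}(x)\sim\Phi_{t_2}(x)$. Prevalence. A Borel set $W\subset\mathbb{R}^n$ is shy if there is a nonzero compactly supported Borel measure $\mu$ on $\mathbb{R}^n$ with $\mu(v+W)=0$ for every $v\in\mathbb{R}^n$; a general set is shy if it is contained in a shy Borel set. A set $W$ is prevalent in $A\subset\mathbb{R}^n$ if $A\setminus W$ is shy. *)

theory Defs
  imports "HOL-Analysis.Analysis"
begin

(* The maximum in the second condition is spelled out as "attained and an upper bound", so that
   the empty set, which contains no subspace, is not a cone. *)
definition k_cone :: "nat \<Rightarrow> 'a::euclidean_space set \<Rightarrow> bool" where
  "k_cone k C \<longleftrightarrow> closed C \<and> (\<forall>v\<in>C. \<forall>l::real. l *\<^sub>R v \<in> C) \<and>
     (\<exists>W. subspace W \<and> W \<subseteq> C \<and> dim W = k) \<and>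
     (\<forall>W. subspace W \<and> W \<subseteq> C \<longrightarrow> dim W \<le> k)"

definition k_solid_cone :: "nat \<Rightarrow> 'a::euclidean_space set \<Rightarrow> bool" where
  "k_solid_cone k C \<longleftrightarrow> k_cone k C \<and>
     (\<exists>W. subspace W \<and> dim W = k \<and> W - {0} \<subseteq> interior C)"

definition ordered :: "'a::euclidean_space set \<Rightarrow> 'a \<Rightarrow> 'a \<Rightarrow> bool" where
  "ordered C x y \<longleftrightarrow> x - y \<in> C"

definition strongly_ordered :: "'a::euclidean_space set \<Rightarrow> 'a \<Rightarrow> 'a \<Rightarrow> bool" where
  "strongly_ordered C x y \<longleftrightarrow> x - y \<in> interior C"

definition flow :: "(real \<Rightarrow> 'a::euclidean_space \<Rightarrow> 'a) \<Rightarrow> bool" where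
  "flow \<Phi> \<longleftrightarrow> continuous_on UNIV (\<lambda>(t, x). \<Phi> t x) \<and> \<Phi> 0 = id \<and> (\<forall>t s. \<Phi> t \<circ> \<Phi> s = \<Phi> (t + s))"

definition locally_Hoelder ::
    "real \<Rightarrow> ('a::metric_space \<Rightarrow> 'b::metric_space) \<Rightarrow> bool" where
  "locally_Hoelder \<alpha> g \<longleftrightarrow>
     (\<forall>p. \<exists>e>0. \<exists>K. \<forall>y\<in>ball p e. \<forall>z\<in>ball p e. dist (g y) (g z) \<le> K * dist y z powr \<alpha>)"

definition C1_Hoelder ::
    "real \<Rightarrow> ('a::real_normed_vector \<Rightarrow> 'b::real_normed_vector) \<Rightarrow> bool" where
  "C1_Hoelder \<alpha> f \<longleftrightarrow>
     (\<exists>f' :: 'a \<Rightarrow> 'a \<Rightarrow>\<^sub>L 'b. (\<forall>p. (f has_derivative blinfun_apply (f' p)) (at p)) \<and>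
        continuous_on UNIV f' \<and> locally_Hoelder \<alpha> f')"

(* Joint regularity in (t, x). *)
definition C1_Hoelder_flow :: "real \<Rightarrow> (real \<Rightarrow> 'a::euclidean_space \<Rightarrow> 'a) \<Rightarrow> bool" where
  "C1_Hoelder_flow \<alpha> \<Phi> \<longleftrightarrow> flow \<Phi> \<and> C1_Hoelder \<alpha> (\<lambda>(t, x). \<Phi> t x)"

definition strongly_monotone ::
    "'a::euclidean_space set \<Rightarrow> (real \<Rightarrow> 'a \<Rightarrow> 'a) \<Rightarrow> bool" where
  "strongly_monotone C \<Phi> \<longleftrightarrow>
     (\<forall>x y t. x \<noteq> y \<and> ordered C x y \<and> t > 0 \<longrightarrow> strongly_ordered C (\<Phi> t x) (\<Phi> t y))"

definition orbit :: "(real \<Rightarrow> 'a \<Rightarrow> 'a) \<Rightarrow> 'a \<Rightarrow> 'a set" where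
  "orbit \<Phi> x = {\<Phi> t x |t. t \<ge> 0}"

definition omega_limit :: "(real \<Rightarrow> 'a::topological_space \<Rightarrow> 'a) \<Rightarrow> 'a \<Rightarrow> 'a set" where
  "omega_limit \<Phi> x = (\<Inter>s\<in>{0..}. closure (\<Union>t\<in>{s..}. {\<Phi> t x}))"

definition pseudo_ordered_orbit ::
    "'a::euclidean_space set \<Rightarrow> (real \<Rightarrow> 'a \<Rightarrow> 'a) \<Rightarrow> 'a \<Rightarrow> bool" where
  "pseudo_ordered_orbit C \<Phi> x \<longleftrightarrow> \<not> is_singleton (orbit \<Phi> x) \<and>
     (\<exists>t\<^sub>1\<ge>0. \<exists>t\<^sub>2\<ge>0. \<Phi> t\<^sub>1 x \<noteq> \<Phi> t\<^sub>2 x \<and> ordered C (\<Phi> t\<^sub>1 x) (\<Phi> t\<^sub>2 x))"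

definition pseudo_ordered_set ::
    "'a::euclidean_space set \<Rightarrow> (real \<Rightarrow> 'a \<Rightarrow> 'a) \<Rightarrow> 'a set" where
  "pseudo_ordered_set C \<Phi> = {x. pseudo_ordered_orbit C \<Phi> x}"

(* A compactly supported Borel measure is understood to be finite (equivalently here, locally
   finite).  Without this, measures with values in {0, \<infinity>} would make unwanted sets shy: the
   measure that is 0 exactly on the Borel sets whose trace on a fixed closed ball is meagre
   would make every meagre Borel set shy. *)
definition shy_Borel :: "'a::euclidean_space set \<Rightarrow> bool" where
  "shy_Borel W \<longleftrightarrow> W \<in> sets borel \<and>
     (\<exists>\<mu>. sets \<mu> = sets borel \<and> finite_measure \<mu> \<and> emeasure \<mu> UNIV \<noteq> 0 \<and>
          (\<exists>K. compact K \<and> emeasure \<mu> (- K) = 0) \<and>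
          (\<forall>v. emeasure \<mu> ((\<lambda>w. v + w) ` W) = 0))"

definition shy :: "'a::euclidean_space set \<Rightarrow> bool" where
  "shy W \<longleftrightarrow> (\<exists>B. shy_Borel B \<and> W \<subseteq> B)"

definition prevalent_in :: "'a::euclidean_space set \<Rightarrow> 'a set \<Rightarrow> bool" where
  "prevalent_in W A \<longleftrightarrow> shy (A - W)"

end

theory Submission
  imports Defs
begin

text \<open>
  Since \<open>k \<ge> 1\<close>, the cone contains a nonzero vector \<open>w\<close>. Every line parallel to \<open>w\<close> meets the set of points of
  \<open>D\<close> that violate the conclusion in at most \<open>N\<close> points, with one \<open>N\<close> for all lines. Such a
  set is Lebesgue null: its translates along \<open>w\<close> overlap at most \<open>N\<close> times, so arbitrarily many
  of them fit, up to the factor \<open>N\<close>, into a ball. A null set is shy, with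
  Lebesgue measure on the unit ball as the witness.

  For the bound \<open>N\<close>, take two points \<open>x \<noteq> y\<close> with \<open>y - x \<in> C\<close>, where \<open>x\<close> is not an equilibrium and no
  two points of its orbit are strongly ordered. Compare \<open>u n\<close>, the velocity of the orbit of \<open>x\<close> at
  time \<open>n\<close>, with \<open>v n\<close>, the difference of the two orbits at time \<open>n\<close>. The vector \<open>u n\<close> never enters the
  cone (\<open>velocity_notin_cone\<close>: otherwise the orbit would contain strongly ordered points), whereas
  \<open>v n\<close> always lies in it. Vectors inside an invariant cone dominate those outside exponentially.
  The quantitative form used here measures the ratio of \<open>u\<close> to \<open>v\<close> by the least \<open>r\<close> such that
  \<open>u + s v \<in> C\<close> for all \<open>\<bar>s\<bar> \<ge> r\<close>: since the derivative maps the cone into its interior, this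
  number shrinks by a factor \<open>\<theta> < 1\<close> in every step, and by compactness the same \<open>\<theta>\<close>
  works on a whole ball and tolerates a small error in \<open>v\<close> (\<open>cone_contraction\<close>). The error is small as
  long as the two orbits are \<open>\<delta>\<close>-close. So if they were \<open>\<delta>\<close>-close at all integer times, then
  \<open>u n\<close> would decay geometrically, the orbit of \<open>x\<close> would have finite length, and \<open>\<omega>(x)\<close> would be a
  singleton. Hence two ordered exceptional points are at distance more than \<open>\<delta>\<close> at some integer
  time (\<open>ordered_companion_separates\<close>).

  Finally, cover the ball that contains all orbits by finitely many small balls, and record for
  each point which of them its orbit visits. If \<open>x\<close> and \<open>y\<close> are separated as above and visit the
  same small balls, then the separated point of the orbit of \<open>y\<close> may be replaced by a nearby point of the
  orbit of \<open>x\<close>; one unit of time later the orbit of \<open>x\<close> contains two strongly ordered points. So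
  on a line parallel to \<open>w\<close> different exceptional points have different records, and there
  are only finitely many records (\<open>exceptional_lines\<close>).
\<close>

section \<open>Vectors inside and outside an invariant cone\<close>

text \<open>
  The least \<open>r\<close> with \<open>u + s v \<in> C\<close> for all \<open>\<bar>s\<bar> \<ge> r\<close> measures the size of \<open>u\<close> relative to
  \<open>v\<close> in terms of the cone alone. Applying \<open>A\<close> cannot increase it, because
  \<open>A (u + s v) = A u + s A v\<close>. It decreases strictly because the vector \<open>u + s v\<close> for the
  extremal \<open>s\<close> lies in \<open>C - {0}\<close>, hence has its image in the interior. After rescaling \<open>u\<close>, \<open>v\<close> and
  the coefficients to unit size, compactness makes the decrease uniform and leaves room for a
  perturbation \<open>v'\<close> of \<open>A v\<close>; a single \<open>\<epsilon>\<close> can serve as the gain and as the tolerance.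
\<close>

lemma cone_contraction:
  fixes C :: "'a::euclidean_space set" and \<A> :: "('a \<Rightarrow>\<^sub>L 'a) set"
  assumes "closed C" and hom: "\<And>v l. v \<in> C \<Longrightarrow> l *\<^sub>R v \<in> C"
    and "compact \<A>" and pos: "\<And>A v. A \<in> \<A> \<Longrightarrow> v \<in> C \<Longrightarrow> v \<noteq> 0 \<Longrightarrow> blinfun_apply A v \<in> interior C"
  obtains \<theta> \<eta> where "0 < \<theta>" "\<theta> < 1" "0 < \<eta>"
    "\<And>A u v v' r s. \<lbrakk>A \<in> \<A>; u \<noteq> 0; blinfun_apply A u \<notin> C; v \<in> C; v \<noteq> 0;
        norm (v' - blinfun_apply A v) \<le> \<eta> * norm v; \<And>s. r \<le> \<bar>s\<bar> \<Longrightarrow> u + s *\<^sub>R v \<in> C; \<theta> * r \<le> \<bar>s\<bar>\<rbrakk>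
      \<Longrightarrow> blinfun_apply A u + s *\<^sub>R v' \<in> C"
proof -
  \<comment> \<open>The pair \<open>(a, b)\<close> on the unit circle replaces the unbounded coefficient \<open>s = b / a\<close>.\<close>
  define good where "good \<epsilon> \<longleftrightarrow> (\<forall>A u v v' a b. A \<in> \<A> \<longrightarrow> norm u = 1 \<longrightarrow> blinfun_apply A u \<notin> C \<longrightarrow> v \<in> C \<longrightarrow>
    norm v = 1 \<longrightarrow> a\<^sup>2 + b\<^sup>2 = 1 \<longrightarrow> norm (v' - blinfun_apply A v) \<le> \<epsilon> \<longrightarrow> a *\<^sub>R u + (b / (1 - \<epsilon>)) *\<^sub>R v \<in> C \<longrightarrow>
    a *\<^sub>R blinfun_apply A u + b *\<^sub>R v' \<in> C)" for \<epsilon> :: real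
  have "\<exists>\<epsilon>\<in>{0<..<1}. good \<epsilon>"
  proof (rule ccontr)
    assume no: "\<not> (\<exists>\<epsilon>\<in>{0<..<1}. good \<epsilon>)"
    define e where "e n = 1 / (real n + 2)" for n :: nat
    have e01: "e n \<in> {0<..<1}" for n by (auto simp: e_def field_simps)
    have "\<forall>n. \<exists>A u v v' a b. A \<in> \<A> \<and> norm u = 1 \<and> blinfun_apply A u \<notin> C \<and> v \<in> C \<and>
      norm v = 1 \<and> a\<^sup>2 + b\<^sup>2 = 1 \<and> norm (v' - blinfun_apply A v) \<le> e n \<and> a *\<^sub>R u + (b / (1 - e n)) *\<^sub>R v \<in> C \<and>
      a *\<^sub>R blinfun_apply A u + b *\<^sub>R v' \<notin> C"
      using no e01 unfolding good_def by blast
    then obtain A u v v' a b where *: "\<And>n. A n \<in> \<A> \<and> norm (u n) = 1 \<and> blinfun_apply (A n) (u n) \<notin> C \<and> v n \<in> C \<and>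
      norm (v n) = 1 \<and> (a n)\<^sup>2 + (b n)\<^sup>2 = 1 \<and> norm (v' n - blinfun_apply (A n) (v n)) \<le> e n \<and>
      a n *\<^sub>R u n + (b n / (1 - e n)) *\<^sub>R v n \<in> C \<and>
      a n *\<^sub>R blinfun_apply (A n) (u n) + b n *\<^sub>R v' n \<notin> C"
      by metis
    define X where "X = \<A> \<times> sphere (0::'a) 1 \<times> sphere (0::'a) 1 \<times> sphere (0::real \<times> real) 1"
    have "compact X" unfolding X_def by (intro compact_Times compact_sphere assms)
    then have sc: "seq_compact X" by (simp only: compact_eq_seq_compact_metric)
    have mem: "\<forall>n. (A n, u n, v n, a n, b n) \<in> X"
      using * by (auto simp: X_def norm_Pair)
    obtain l \<sigma> where l: "l \<in> X" "strict_mono \<sigma>" "((\<lambda>n. (A n, u n, v n, a n, b n)) \<circ> \<sigma>) \<longlonglongrightarrow> l"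
      by (rule seq_compactE[OF sc mem])
    obtain A0 u0 v0 a0 b0 where l0: "l = (A0, u0, v0, a0, b0)" by (metis prod.exhaust)
    note lim = l(3)[unfolded l0 o_def]
    have A: "(\<lambda>n. A (\<sigma> n)) \<longlonglongrightarrow> A0" using tendsto_fst[OF lim] by simp
    have u: "(\<lambda>n. u (\<sigma> n)) \<longlonglongrightarrow> u0" using tendsto_fst[OF tendsto_snd[OF lim]] by simp
    have v: "(\<lambda>n. v (\<sigma> n)) \<longlonglongrightarrow> v0" using tendsto_fst[OF tendsto_snd[OF tendsto_snd[OF lim]]] by simp
    have a: "(\<lambda>n. a (\<sigma> n)) \<longlonglongrightarrow> a0"
      using tendsto_fst[OF tendsto_snd[OF tendsto_snd[OF tendsto_snd[OF lim]]]] by simp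
    have b: "(\<lambda>n. b (\<sigma> n)) \<longlonglongrightarrow> b0"
      using tendsto_snd[OF tendsto_snd[OF tendsto_snd[OF tendsto_snd[OF lim]]]] by simp
    have X0: "A0 \<in> \<A>" "norm u0 = 1" "norm v0 = 1" "a0\<^sup>2 + b0\<^sup>2 = 1"
      using l(1) by (auto simp: l0 X_def norm_Pair)
    have "e \<longlonglongrightarrow> 0"
      using LIMSEQ_Suc[OF LIMSEQ_inverse_real_of_nat] by (simp add: e_def[abs_def] field_simps)
    then have e: "(\<lambda>n. e (\<sigma> n)) \<longlonglongrightarrow> 0" using LIMSEQ_subseq_LIMSEQ[OF _ l(2)] by (auto simp: o_def)
    have v': "(\<lambda>n. v' (\<sigma> n)) \<longlonglongrightarrow> blinfun_apply A0 v0"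
    proof -
      have "(\<lambda>n. v' (\<sigma> n) - blinfun_apply (A (\<sigma> n)) (v (\<sigma> n))) \<longlonglongrightarrow> 0"
        by (rule tendsto_0_le[OF e, of _ 1]) (use * e01 in \<open>auto simp: less_imp_le intro!: always_eventually\<close>)
      from tendsto_add[OF this blinfun.tendsto[OF A v]] show ?thesis by simp
    qed
    have mem2: "a (\<sigma> n) *\<^sub>R u (\<sigma> n) + (b (\<sigma> n) / (1 - e (\<sigma> n))) *\<^sub>R v (\<sigma> n) \<in> C" for n
      using *[of "\<sigma> n"] by simp
    have "(\<lambda>n. a (\<sigma> n) *\<^sub>R u (\<sigma> n) + (b (\<sigma> n) / (1 - e (\<sigma> n))) *\<^sub>R v (\<sigma> n)) \<longlonglongrightarrow> a0 *\<^sub>R u0 + (b0 / (1 - 0)) *\<^sub>R v0"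
      by (intro tendsto_intros a b e u v) auto
    then have "a0 *\<^sub>R u0 + (b0 / (1 - 0)) *\<^sub>R v0 \<in> C"
      by (rule closed_sequentially[OF \<open>closed C\<close>, rotated]) (rule mem2)
    then have inC: "a0 *\<^sub>R u0 + b0 *\<^sub>R v0 \<in> C" by simp
    have v0: "v0 \<in> C" by (rule closed_sequentially[OF \<open>closed C\<close> _ v]) (simp add: *)
    have cl: "closed (- interior C)" by (rule closed_Compl[OF open_interior])
    have Au: "blinfun_apply A0 u0 \<notin> interior C"
    proof -
      have "blinfun_apply (A (\<sigma> n)) (u (\<sigma> n)) \<in> - interior C" for n
        using *[of "\<sigma> n"] interior_subset[of C] by auto
      from closed_sequentially[OF cl this blinfun.tendsto[OF A u]] show ?thesis by simp
    qed
    have u0: "u0 \<notin> C" using pos[OF X0(1), of u0] Au X0(2) by (cases "u0 = 0") auto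
    \<comment> \<open>Otherwise \<open>u0\<close> would be a multiple of \<open>v0\<close>, and so in the cone.\<close>
    have nz: "a0 *\<^sub>R u0 + b0 *\<^sub>R v0 \<noteq> 0"
    proof
      assume z: "a0 *\<^sub>R u0 + b0 *\<^sub>R v0 = 0"
      show False
      proof (cases "a0 = 0")
        case True
        then have "b0 *\<^sub>R v0 = 0" "b0\<^sup>2 = 1" using z X0(4) by simp_all
        then have "v0 = 0" by auto
        then show False using X0(3) by simp
      next
        case False
        have "u0 = (1/a0) *\<^sub>R (a0 *\<^sub>R u0)" using False by simp
        also have "a0 *\<^sub>R u0 = - b0 *\<^sub>R v0" using z by (simp add: eq_neg_iff_add_eq_0)
        finally show False using u0 hom[OF hom[OF v0, of "- b0"], of "1/a0"] by simp
      qed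
    qed
    have lim3: "(\<lambda>n. a (\<sigma> n) *\<^sub>R blinfun_apply (A (\<sigma> n)) (u (\<sigma> n)) + b (\<sigma> n) *\<^sub>R v' (\<sigma> n)) \<longlonglongrightarrow>
       a0 *\<^sub>R blinfun_apply A0 u0 + b0 *\<^sub>R blinfun_apply A0 v0"
      by (intro tendsto_intros a b v' A u)
    have mem3: "a (\<sigma> n) *\<^sub>R blinfun_apply (A (\<sigma> n)) (u (\<sigma> n)) + b (\<sigma> n) *\<^sub>R v' (\<sigma> n) \<in> - interior C" for n
      using *[of "\<sigma> n"] interior_subset[of C] by auto
    have "a0 *\<^sub>R blinfun_apply A0 u0 + b0 *\<^sub>R blinfun_apply A0 v0 \<in> - interior C"
      by (rule closed_sequentially[OF cl mem3 lim3])
    moreover have "blinfun_apply A0 (a0 *\<^sub>R u0 + b0 *\<^sub>R v0) \<in> interior C"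
      using pos[OF X0(1) inC nz] .
    ultimately show False by (simp add: blinfun.bilinear_simps)
  qed
  then obtain \<epsilon> where \<epsilon>: "0 < \<epsilon>" "\<epsilon> < 1" "good \<epsilon>" by auto
  show thesis
  proof (rule that[of "1 - \<epsilon>" \<epsilon>])
    fix A u v v' r s
    assume A: "A \<in> \<A>" "u \<noteq> 0" "blinfun_apply A u \<notin> C" "v \<in> C" "v \<noteq> 0"
      "norm (v' - blinfun_apply A v) \<le> \<epsilon> * norm v" "\<And>s. r \<le> \<bar>s\<bar> \<Longrightarrow> u + s *\<^sub>R v \<in> C" "(1 - \<epsilon>) * r \<le> \<bar>s\<bar>"
    define m where "m = sqrt ((norm u)\<^sup>2 + (s * norm v)\<^sup>2)"
    have m: "m > 0" "m\<^sup>2 = (norm u)\<^sup>2 + (s * norm v)\<^sup>2" using A(2) by (auto simp: m_def add_pos_nonneg)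
    define u1 v1 v1' a b where "u1 = (1 / norm u) *\<^sub>R u" and "v1 = (1 / norm v) *\<^sub>R v"
      and "v1' = (1 / norm v) *\<^sub>R v'" and "a = norm u / m" and "b = s * norm v / m"
    have "blinfun_apply A u = norm u *\<^sub>R blinfun_apply A u1" using A(2) by (simp add: u1_def blinfun.bilinear_simps)
    then have 1: "blinfun_apply A u1 \<notin> C" using A(3) hom by metis
    have 2: "a\<^sup>2 + b\<^sup>2 = 1"
    proof -
      have "a\<^sup>2 + b\<^sup>2 = ((norm u)\<^sup>2 + (s * norm v)\<^sup>2) / m\<^sup>2" by (simp add: a_def b_def power_divide add_divide_distrib)
      then show ?thesis using m A(2) by simp
    qed
    have "v1' - blinfun_apply A v1 = (1 / norm v) *\<^sub>R (v' - blinfun_apply A v)"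
      by (simp add: v1'_def v1_def blinfun.bilinear_simps scaleR_diff_right)
    then have "norm (v1' - blinfun_apply A v1) = norm (v' - blinfun_apply A v) / norm v"
      by (simp only: norm_scaleR) simp
    then have 3: "norm (v1' - blinfun_apply A v1) \<le> \<epsilon>" using A(5,6) by (simp add: pos_divide_le_eq)
    have "r \<le> \<bar>s / (1 - \<epsilon>)\<bar>" using A(8) \<epsilon> by (simp add: abs_divide field_simps)
    then have "(1/m) *\<^sub>R (u + (s / (1 - \<epsilon>)) *\<^sub>R v) \<in> C" using A(7) hom by blast
    also have "(1/m) *\<^sub>R (u + (s / (1 - \<epsilon>)) *\<^sub>R v) = a *\<^sub>R u1 + (b / (1 - \<epsilon>)) *\<^sub>R v1"
      using A(2,5) by (simp add: a_def b_def u1_def v1_def scaleR_add_right)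
    finally have 4: "a *\<^sub>R u1 + (b / (1 - \<epsilon>)) *\<^sub>R v1 \<in> C" .
    have "norm u1 = 1" "norm v1 = 1" "v1 \<in> C" using A(2,4,5) hom by (auto simp: u1_def v1_def)
    then have 5: "a *\<^sub>R blinfun_apply A u1 + b *\<^sub>R v1' \<in> C"
      using \<open>good \<epsilon>\<close>[unfolded good_def, rule_format, OF A(1) _ 1 _ _ 2 3 4] by blast
    have "m *\<^sub>R (a *\<^sub>R blinfun_apply A u1 + b *\<^sub>R v1') = blinfun_apply A u + s *\<^sub>R v'"
      using A(2,5) m(1) by (simp add: a_def b_def u1_def v1'_def scaleR_add_right blinfun.bilinear_simps)
    then show "blinfun_apply A u + s *\<^sub>R v' \<in> C" using hom[OF 5, of m] by simp
  qed (use \<epsilon> in auto)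
qed

text \<open>
  The converse comparison: unit vectors whose image is still outside the interior stay at a
  positive distance from \<open>C\<close>, and \<open>u + r v\<close> is a point of \<open>C\<close> at distance \<open>r \<parallel>v\<parallel>\<close> from \<open>u\<close>.
\<close>

lemma cone_comparison_lower_bound:
  fixes C :: "'a::euclidean_space set" and \<A> :: "('a \<Rightarrow>\<^sub>L 'a) set"
  assumes "closed C" and hom: "\<And>v l. v \<in> C \<Longrightarrow> l *\<^sub>R v \<in> C"
    and "compact \<A>" and pos: "\<And>A v. A \<in> \<A> \<Longrightarrow> v \<in> C \<Longrightarrow> v \<noteq> 0 \<Longrightarrow> blinfun_apply A v \<in> interior C"
  obtains c where "0 < c"
    "\<And>A u v r. \<lbrakk>A \<in> \<A>; blinfun_apply A u \<notin> C; 0 \<le> r; \<And>s. r \<le> \<bar>s\<bar> \<Longrightarrow> u + s *\<^sub>R v \<in> C\<rbrakk>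
      \<Longrightarrow> c * norm u \<le> r * norm v"
proof -
  define U where "U = snd ` ((\<A> \<times> sphere 0 1) \<inter> (\<lambda>(A, u). blinfun_apply A u) -` (- interior C))"
  have cl: "closed ((\<lambda>(A::'a \<Rightarrow>\<^sub>L 'a, u). blinfun_apply A u) -` (- interior C))"
    unfolding case_prod_unfold
    by (rule closed_vimage[OF closed_Compl[OF open_interior]])
      (rule blinfun.continuous_on continuous_on_fst[OF continuous_on_id] continuous_on_snd[OF continuous_on_id])+
  have "compact ((\<A> \<times> sphere 0 1) \<inter> (\<lambda>(A, u). blinfun_apply A u) -` (- interior C))"
    by (rule compact_Int_closed[OF compact_Times[OF \<open>compact \<A>\<close> compact_sphere] cl])
  then have "compact U" unfolding U_def
    by (rule compact_continuous_image[OF continuous_on_snd[OF continuous_on_id]])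
  have "u \<notin> C" if uU: "u \<in> U" for u
  proof -
    obtain A where "A \<in> \<A>" "norm u = 1" "blinfun_apply A u \<notin> interior C" using uU by (auto simp: U_def)
    then show ?thesis using pos[of A u] by (cases "u = 0") auto
  qed
  then have disj: "U \<inter> C = {}" by blast
  obtain d where d: "d > 0" "\<And>x y. x \<in> U \<Longrightarrow> y \<in> C \<Longrightarrow> d \<le> dist x y"
    using separate_compact_closed[OF \<open>compact U\<close> \<open>closed C\<close> disj] by blast
  show thesis
  proof (rule that[OF d(1)])
    fix A u v r
    assume A: "A \<in> \<A>" "blinfun_apply A u \<notin> C" "0 \<le> r" "\<And>s. r \<le> \<bar>s\<bar> \<Longrightarrow> u + s *\<^sub>R v \<in> C"
    show "d * norm u \<le> r * norm v"
    proof (cases "u = 0")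
      case False
      have "blinfun_apply A u = norm u *\<^sub>R blinfun_apply A (sgn u)" 
        using False by (simp add: sgn_div_norm blinfun.bilinear_simps)
      then have "blinfun_apply A (sgn u) \<notin> C" using A(2) hom by metis
      then have "sgn u \<in> U" using A(1) False interior_subset[of C] unfolding U_def
        by (intro image_eqI[of _ _ "(A, sgn u)"]) (auto simp: norm_sgn)
      moreover have "(1 / norm u) *\<^sub>R (u + r *\<^sub>R v) \<in> C" using A(4)[of r] A(3) hom by auto
      ultimately have "d \<le> dist (sgn u) ((1 / norm u) *\<^sub>R (u + r *\<^sub>R v))" using d(2) by blast
      also have "\<dots> = norm ((r / norm u) *\<^sub>R v)"
        by (simp add: dist_norm sgn_div_norm scaleR_add_right divide_inverse_commute)
      also have "\<dots> = r * norm v / norm u" using A(3) by simp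
      finally show ?thesis using False by (simp add: field_simps)
    qed (use A in auto)
  qed
qed

lemma interior_scaleR_homogeneous:
  fixes C :: "'a::euclidean_space set"
  assumes hom: "\<And>v l. v \<in> C \<Longrightarrow> l *\<^sub>R v \<in> C" and "v \<in> interior C" "r \<noteq> 0"
  shows "r *\<^sub>R v \<in> interior C"
proof -
  have "open ((*\<^sub>R) r ` interior C)" using assms by (intro open_scaling) auto
  moreover have "(*\<^sub>R) r ` interior C \<subseteq> C" using hom interior_subset by blast
  ultimately have "(*\<^sub>R) r ` interior C \<subseteq> interior C" by (rule interior_maximal[rotated])
  then show ?thesis using assms(2) by blast
qed

lemma eventually_in_cone:
  fixes C :: "'a::euclidean_space set"
  assumes hom: "\<And>v l. v \<in> C \<Longrightarrow> l *\<^sub>R v \<in> C" and v: "v \<in> interior C"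
  obtains r where "0 \<le> r" "\<And>s. r \<le> \<bar>s\<bar> \<Longrightarrow> u + s *\<^sub>R v \<in> C"
proof -
  obtain e where e: "e > 0" "cball v e \<subseteq> C" using v by (auto simp: mem_interior_cball)
  show thesis
  proof (rule that[of "norm u / e + 1"])
    fix s :: real assume s: "norm u / e + 1 \<le> \<bar>s\<bar>"
    have "0 \<le> norm u / e" using e(1) by simp
    then have s0: "s \<noteq> 0" using s by auto
    have "norm u / e \<le> \<bar>s\<bar>" using s by simp
    then have "norm u / \<bar>s\<bar> \<le> e" using e(1) s0 by (simp add: field_simps)
    then have "v + (1/s) *\<^sub>R u \<in> cball v e" by (simp add: dist_norm)
    then have "s *\<^sub>R (v + (1/s) *\<^sub>R u) \<in> C" using e(2) hom by blast
    then show "u + s *\<^sub>R v \<in> C" using s0 by (simp add: scaleR_add_right add.commute)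
  qed (use e in simp)
qed

lemma cone_eq_UNIV_if_zero_interior:
  fixes C :: "'a::euclidean_space set"
  assumes hom: "\<And>v l. v \<in> C \<Longrightarrow> l *\<^sub>R v \<in> C" and "0 \<in> interior C"
  shows "C = UNIV"
proof -
  have "u \<in> C" for u
    using eventually_in_cone[OF hom assms(2), of u] by (metis abs_ge_self add.right_neutral scaleR_zero_right)
  then show ?thesis by blast
qed

section \<open>Null sets and shy sets\<close>

lemma emeasure_translation_lborel:
  fixes B :: "'a::euclidean_space set"
  assumes "B \<in> sets borel"
  shows "emeasure lborel ((+) v -` B) = emeasure lborel B"
proof -
  have "emeasure lborel B = emeasure (distr lborel borel ((+) v)) B"
    by (simp add: lborel_distr_plus)
  also have "\<dots> = emeasure lborel ((+) v -` B \<inter> space lborel)"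
    by (rule emeasure_distr) (use assms in auto)
  finally show ?thesis by simp
qed

text \<open>
  A point lies in at most \<open>N\<close> of the translates of \<open>B\<close> by multiples of \<open>w\<close>. Integrating the sum of the
  indicators of \<open>m\<close> translates, all contained in one ball \<open>K\<close>, gives
  \<open>m \<lambda>(B) \<le> N \<lambda>(K)\<close> for every \<open>m\<close>.
\<close>

lemma null_set_if_lines_meet_boundedly_often:
  fixes B :: "'a::euclidean_space set" and w :: 'a
  assumes B: "B \<in> sets borel" "bounded B"
    and few: "\<And>x S. finite S \<Longrightarrow> (\<And>s. s \<in> S \<Longrightarrow> x + s *\<^sub>R w \<in> B) \<Longrightarrow> card S \<le> N"
  shows "emeasure lborel B = 0"
proof -
  obtain R where R: "\<And>x. x \<in> B \<Longrightarrow> norm x \<le> R" using B(2) by (auto simp: bounded_iff)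
  define K where "K = cball (0::'a) (R + norm w)"
  define T where "T s = (+) (s *\<^sub>R w) -` B" for s :: real
  have T: "T s \<in> sets lborel" for s
    unfolding T_def using measurable_sets[of "(+) (s *\<^sub>R w)" borel borel B] B by simp
  have finK: "emeasure lborel K < \<infinity>" unfolding K_def by (rule emeasure_lborel_cball_finite)
  have le: "of_nat m * emeasure lborel B \<le> of_nat N * emeasure lborel K" for m :: nat
  proof -
    \<comment> \<open>Any \<open>m\<close> distinct shifts in the unit interval would do.\<close>
    define S where "S = (\<lambda>i. 1 / real (Suc i)) ` {..<m}"
    have S: "finite S" "card S = m" "\<And>s. s \<in> S \<Longrightarrow> \<bar>s\<bar> \<le> 1"
      unfolding S_def by (auto intro!: card_image[THEN trans] inj_onI simp: field_simps)
    have "(\<Sum>s\<in>S. indicator (T s) x) \<le> (of_nat N * indicator K x :: ennreal)" for x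
    proof -
      have "(\<Sum>s\<in>S. indicator (T s) x) = (of_nat (card {s\<in>S. x \<in> T s}) :: ennreal)"
        using S(1) by (simp add: indicator_def sum.If_cases Int_def)
      moreover have "card {s\<in>S. x \<in> T s} \<le> N"
        by (rule few[of _ x]) (use S(1) in \<open>auto simp: T_def add.commute\<close>)
      moreover have "x \<in> K" if "s \<in> S" "x \<in> T s" for s
      proof -
        have "norm (s *\<^sub>R w + x) \<le> R" using that R by (auto simp: T_def)
        moreover have "norm (s *\<^sub>R w) \<le> norm w"
          using mult_right_mono[OF S(3)[OF that(1)], of "norm w"] by simp
        ultimately have "norm x \<le> R + norm w"
          using norm_triangle_ineq4[of "s *\<^sub>R w + x" "s *\<^sub>R w"] by simp
        then show ?thesis by (simp add: K_def)
      qed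
      then have "{s\<in>S. x \<in> T s} = {} \<or> x \<in> K" by blast
      ultimately show ?thesis by (auto simp: of_nat_mono)
    qed
    then have "(\<integral>\<^sup>+x. (\<Sum>s\<in>S. indicator (T s) x) \<partial>lborel) \<le> (\<integral>\<^sup>+x. of_nat N * indicator K x \<partial>lborel)"
      by (intro nn_integral_mono)
    also have "(\<integral>\<^sup>+x. (\<Sum>s\<in>S. indicator (T s) x) \<partial>lborel) = (\<Sum>s\<in>S. emeasure lborel (T s))"
      using T by (subst nn_integral_sum) auto
    also have "\<dots> = of_nat m * emeasure lborel B"
      using S(2) by (simp add: T_def emeasure_translation_lborel[OF B(1)])
    also have "(\<integral>\<^sup>+x. of_nat N * indicator K x \<partial>lborel) = of_nat N * emeasure lborel K"
      by (subst nn_integral_cmult_indicator) (auto simp: K_def)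
    finally show ?thesis .
  qed
  show ?thesis
  proof (rule ccontr)
    assume nz: "emeasure lborel B \<noteq> 0"
    have "emeasure lborel B < \<infinity>" using B(2) by (rule emeasure_bounded_finite)
    then obtain b where b: "emeasure lborel B = ennreal b" "b > 0"
      using nz by (cases "emeasure lborel B") auto
    obtain c where c: "emeasure lborel K = ennreal c" "c \<ge> 0"
      using finK by (cases "emeasure lborel K") auto
    obtain m :: nat where "real N * c / b < real m" using reals_Archimedean2 by blast
    then have "real N * c < real m * b" using b(2) by (simp add: field_simps)
    moreover have "ennreal (real m * b) \<le> ennreal (real N * c)"
      using le[of m] b c by (simp add: ennreal_mult ennreal_of_nat_eq_real_of_nat)
    ultimately show False using c(2) by (simp add: ennreal_le_iff)
  qed
qed

lemma shy_Borel_if_lborel_null: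
  fixes B :: "'a::euclidean_space set"
  assumes B: "B \<in> sets borel" "emeasure lborel B = 0"
  shows "shy_Borel B"
proof -
  define \<mu> :: "'a measure" where "\<mu> = density lborel (indicator (cball 0 1))"
  have em: "emeasure \<mu> A = emeasure lborel (cball 0 1 \<inter> A)" if "A \<in> sets borel" for A
    unfolding \<mu>_def using that by (subst emeasure_density) (auto simp: nn_integral_indicator indicator_inter_arith[symmetric] intro!: borel_measurable_indicator)
  have U: "emeasure \<mu> UNIV = emeasure lborel (cball (0::'a) 1)" by (simp add: em)
  have "finite_measure \<mu>"
    by (rule finite_measureI) (use U emeasure_lborel_cball_finite[of "0::'a" 1] in \<open>auto simp: \<mu>_def\<close>)
  moreover have "emeasure \<mu> UNIV \<noteq> 0"
  proof
    assume "emeasure \<mu> UNIV = 0"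
    then have "emeasure lborel (ball (0::'a) 1) = 0"
      using emeasure_mono[of "ball 0 1" "cball (0::'a) 1" lborel] U by auto
    then have "negligible (ball (0::'a) 1)"
      by (auto simp: negligible_iff_emeasure0 emeasure_completion)
    then show False using open_not_negligible[of "ball (0::'a) 1"] by simp
  qed
  moreover have "emeasure \<mu> (- cball 0 1) = 0" by (subst em) auto
  moreover have "emeasure \<mu> ((\<lambda>w. v + w) ` B) = 0" for v
  proof -
    have im: "(\<lambda>w. v + w) ` B = (+) (-v) -` B"
      by (force intro: image_eqI[where x = "_ - v"])
    have m: "(+) (-v) -` B \<in> sets borel"
      using measurable_sets[of "(+) (-v)" borel borel B] B by simp
    have "emeasure lborel (cball 0 1 \<inter> (+) (-v) -` B) \<le> emeasure lborel ((+) (-v) -` B)"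
      by (rule emeasure_mono) (use m in auto)
    then show ?thesis using emeasure_translation_lborel[OF B(1), of "-v"] B(2)
      unfolding im by (simp add: em[OF m])
  qed
  moreover have "sets \<mu> = sets borel" by (simp add: \<mu>_def)
  ultimately show ?thesis unfolding shy_Borel_def using B(1) compact_cball by blast
qed

section \<open>Continuously differentiable flows\<close>

text \<open>
  The derivative \<open>J\<close> is taken jointly in time and space; it yields both the velocity field
  and the derivatives of the time maps.
\<close>

locale C1_flow =
  fixes \<Phi> :: "real \<Rightarrow> 'a::euclidean_space \<Rightarrow> 'a"
    and J :: "real \<times> 'a \<Rightarrow> (real \<times> 'a) \<Rightarrow>\<^sub>L 'a"
  assumes flow: "flow \<Phi>"
    and deriv_joint: "\<And>p. ((\<lambda>(t, x). \<Phi> t x) has_derivative blinfun_apply (J p)) (at p)"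
    and cont_J: "continuous_on UNIV J"
begin

definition velocity :: "'a \<Rightarrow> 'a" where
  "velocity z = blinfun_apply (J (0, z)) (1, 0)"

definition space_deriv :: "real \<Rightarrow> 'a \<Rightarrow> 'a \<Rightarrow>\<^sub>L 'a" where
  "space_deriv t z = J (t, z) o\<^sub>L Blinfun (Pair 0)"

lemma flow_zero [simp]: "\<Phi> 0 z = z"
  using flow by (simp add: flow_def)

lemma flow_add: "\<Phi> t (\<Phi> s z) = \<Phi> (t + s) z"
  using flow unfolding flow_def by (metis comp_apply)

lemma flow_inj: "\<Phi> t x = \<Phi> t y \<Longrightarrow> x = y"
  by (metis flow_add flow_zero add.left_inverse)

lemma space_deriv_apply: "blinfun_apply (space_deriv t z) h = blinfun_apply (J (t, z)) (0, h)"
  unfolding space_deriv_def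
  by (simp add: bounded_linear_Blinfun_apply bounded_linear_Pair bounded_linear_zero bounded_linear_ident)

lemma has_derivative_space:
  "(\<Phi> t has_derivative blinfun_apply (space_deriv t z)) (at z within S)"
proof -
  have "(Pair t has_derivative (\<lambda>h. (0, h))) (at z)"
    by (auto intro!: derivative_eq_intros)
  from diff_chain_at[OF this deriv_joint]
  have "(\<Phi> t has_derivative (\<lambda>h. blinfun_apply (space_deriv t z) h)) (at z)"
    by (simp add: o_def space_deriv_apply)
  then show ?thesis by (rule has_derivative_at_withinI)
qed

lemma has_vector_derivative_orbit:
  "((\<lambda>t. \<Phi> t z) has_vector_derivative velocity (\<Phi> t z)) (at t within S)"
proof -
  have gen: "((\<lambda>t. \<Phi> t z) has_vector_derivative blinfun_apply (J (t, z)) (1, 0)) (at t)" for t z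
  proof -
    have "((\<lambda>t. (t, z)) has_derivative (\<lambda>h. (h, 0))) (at t)"
      by (auto intro!: derivative_eq_intros)
    from diff_chain_at[OF this deriv_joint[of "(t, z)"]]
    have "((\<lambda>t. \<Phi> t z) has_derivative (\<lambda>h. blinfun_apply (J (t, z)) (h, 0))) (at t)"
      by (simp add: o_def)
    moreover have "(h::real, 0::'a) = h *\<^sub>R (1, 0)" for h by simp
    ultimately show ?thesis unfolding has_vector_derivative_def
      by (metis (no_types, lifting) blinfun.scaleR_right ext)
  qed
  have "((\<lambda>s. s - t) has_vector_derivative 1) (at t)"
    by (auto intro!: derivative_eq_intros)
  moreover have "((\<lambda>s. \<Phi> s (\<Phi> t z)) has_vector_derivative velocity (\<Phi> t z)) (at (t - t))"
    using gen[of "\<Phi> t z" 0] by (simp add: velocity_def)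
  ultimately have "((\<lambda>s. \<Phi> s (\<Phi> t z)) \<circ> (\<lambda>s. s - t) has_vector_derivative 1 *\<^sub>R velocity (\<Phi> t z)) (at t)"
    by (rule vector_diff_chain_at)
  then show ?thesis
    by (simp add: o_def flow_add has_vector_derivative_at_within)
qed

text \<open>
  The velocity field is invariant under the linearised flow: differentiate
  \<open>\<Phi> t (\<Phi> s z) = \<Phi> (t + s) z\<close> with respect to \<open>s\<close>.
\<close>

lemma velocity_flow:
  "velocity (\<Phi> (t + s) z) = blinfun_apply (space_deriv t (\<Phi> s z)) (velocity (\<Phi> s z))"
proof -
  have "((\<lambda>s. \<Phi> t (\<Phi> s z)) has_vector_derivative
      blinfun_apply (space_deriv t (\<Phi> s z)) (velocity (\<Phi> s z))) (at s)"
    using vector_derivative_diff_chain_within[OF has_vector_derivative_orbit has_derivative_space] 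
    by (fastforce simp: o_def)
  then have 1: "((\<lambda>s. \<Phi> (t + s) z) has_vector_derivative
      blinfun_apply (space_deriv t (\<Phi> s z)) (velocity (\<Phi> s z))) (at s)"
    by (simp add: flow_add)
  have "((+) t has_vector_derivative 1) (at s)"
    by (auto intro!: derivative_eq_intros)
  from vector_diff_chain_at[OF this has_vector_derivative_orbit]
  have 2: "((\<lambda>s. \<Phi> (t + s) z) has_vector_derivative velocity (\<Phi> (t + s) z)) (at s)"
    by (simp add: o_def)
  show ?thesis using vector_derivative_unique_at[OF 2 1] .
qed

lemma continuous_on_space_deriv [continuous_intros]:
  "continuous_on S f \<Longrightarrow> continuous_on S g \<Longrightarrow> continuous_on S (\<lambda>z. space_deriv (f z) (g z))"
  unfolding space_deriv_def
  by (intro bounded_bilinear.continuous_on[OF bounded_bilinear_blinfun_compose]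
      continuous_on_compose2[OF cont_J] continuous_intros) auto

lemma continuous_on_velocity: "continuous_on S velocity"
  unfolding velocity_def
  by (intro blinfun.continuous_on continuous_on_compose2[OF cont_J] continuous_intros) auto

lemma continuous_on_flow [continuous_intros]:
  assumes "continuous_on S f" "continuous_on S g"
  shows "continuous_on S (\<lambda>z. \<Phi> (f z) (g z))"
proof -
  have "continuous_on UNIV (\<lambda>p. \<Phi> (fst p) (snd p))"
    using flow by (simp add: flow_def case_prod_unfold)
  from continuous_on_compose2[OF this continuous_on_Pair[OF assms]] show ?thesis by simp
qed

lemma velocity_zero_iff: "velocity (\<Phi> t z) = 0 \<longleftrightarrow> velocity z = 0"
proof -
  have imp: "velocity (\<Phi> t z) = 0" if "velocity z = 0" for t z
    using velocity_flow[of t 0 z] that by (simp add: blinfun.bilinear_simps)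
  show ?thesis using imp[of z t] imp[of "\<Phi> t z" "-t"] by (auto simp: flow_add)
qed

text \<open>
  The derivative is uniformly continuous on the ball, so by the mean value inequality on segments
  the difference of two nearby orbits evolves linearly up to a relative error \<open>\<eta>\<close>.
\<close>

lemma flow_step_linearization:
  assumes "0 < \<eta>"
  obtains \<delta> where "0 < \<delta>"
    "\<And>x y. \<lbrakk>norm x \<le> R; norm y \<le> R; norm (y - x) \<le> \<delta>\<rbrakk>
      \<Longrightarrow> norm (\<Phi> t y - \<Phi> t x - blinfun_apply (space_deriv t x) (y - x)) \<le> \<eta> * norm (y - x)"
proof -
  have "uniformly_continuous_on (cball 0 R) (space_deriv t)"
    by (intro compact_uniformly_continuous continuous_intros compact_cball)
  then obtain d where d: "d > 0" "\<And>x x'. x \<in> cball 0 R \<Longrightarrow> x' \<in> cball 0 R \<Longrightarrow> dist x' x < d \<Longrightarrow>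
      dist (space_deriv t x') (space_deriv t x) < \<eta>"
    using assms unfolding uniformly_continuous_on_def by metis
  show thesis
  proof (rule that[of "d / 2"])
    fix x y :: 'a assume xy: "norm x \<le> R" "norm y \<le> R" "norm (y - x) \<le> d / 2"
    define S where "S = cball 0 R \<inter> cball x (d / 2)"
    have "convex S" by (simp add: S_def convex_Int)
    moreover have S: "x \<in> S" "y \<in> S" using xy d(1) by (auto simp: S_def dist_norm norm_minus_commute)
    ultimately have "x + s *\<^sub>R (y - x) \<in> S" if "s \<in> {0..1}" for s
      using that convexD_alt[of S x y s] by (auto simp: algebra_simps)
    moreover have "onorm (\<lambda>h. blinfun_apply (space_deriv t z) h - blinfun_apply (space_deriv t x) h) \<le> \<eta>"
      if "z \<in> S" for z
    proof -
      have "dist (space_deriv t z) (space_deriv t x) < \<eta>"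
        by (rule d(2)) (use that S d(1) in \<open>auto simp: S_def dist_commute\<close>)
      then show ?thesis by (simp add: dist_norm norm_blinfun.rep_eq flip: blinfun.diff_left)
    qed
    ultimately have "norm (\<Phi> t y - \<Phi> t x - blinfun_apply (space_deriv t x) (y - x)) \<le> norm (y - x) * \<eta>"
      by (intro differentiable_bound_linearization[where S = S and f' = "\<lambda>z. blinfun_apply (space_deriv t z)"]
          has_derivative_space S(1)) (auto simp: fun_diff_def)
    then show "norm (\<Phi> t y - \<Phi> t x - blinfun_apply (space_deriv t x) (y - x)) \<le> \<eta> * norm (y - x)"
      by (simp add: mult.commute)
  qed (use d in auto)
qed

text \<open>
  On a time interval of length one the speed is at most a constant multiple of the speed
  at its left end point. Summable speeds at integer times therefore bound the length of the orbit, so the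
  orbit converges. Finite length is preferred to convergence as a criterion because it depends on
  integer times alone, which makes the corresponding set of points evidently Borel.
\<close>

lemma omega_limit_singleton_if_summable:
  assumes bdd: "\<And>t. t \<ge> 0 \<Longrightarrow> norm (\<Phi> t x) \<le> R"
    and summ: "summable (\<lambda>n. norm (velocity (\<Phi> (real n) x)))"
  shows "is_singleton (omega_limit \<Phi> x)"
proof -
  have "bounded ((\<lambda>p. space_deriv (fst p) (snd p)) ` ({0..1} \<times> cball 0 R))"
    by (intro compact_imp_bounded compact_continuous_image continuous_intros compact_Times) auto
  then obtain M where M: "\<And>t z. t \<in> {0..1} \<Longrightarrow> norm z \<le> R \<Longrightarrow> norm (space_deriv t z) \<le> M"
    unfolding bounded_iff by force
  define V where "V n = norm (velocity (\<Phi> (real n) x))" for n :: nat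
  have step: "norm (\<Phi> (real n + s) x - \<Phi> (real n) x) \<le> M * V n" if s: "s \<in> {0..1}" for n s
  proof -
    have "norm (\<Phi> (real n + s) x - \<Phi> (real n) x) \<le> (M * V n) * norm ((real n + s) - real n)"
    proof (rule differentiable_bound[where S = "{real n..real n + s}" and f = "\<lambda>t. \<Phi> t x"])
      show "((\<lambda>t. \<Phi> t x) has_derivative (\<lambda>h. h *\<^sub>R velocity (\<Phi> t x))) (at t within {real n..real n + s})" for t
        using has_vector_derivative_orbit[of x t] unfolding has_vector_derivative_def .
      show "onorm (\<lambda>h. h *\<^sub>R velocity (\<Phi> t x)) \<le> M * V n" if t: "t \<in> {real n..real n + s}" for t
      proof -
        have "norm (velocity (\<Phi> t x)) = norm (blinfun_apply (space_deriv (t - real n) (\<Phi> (real n) x)) (velocity (\<Phi> (real n) x)))"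
          using velocity_flow[of "t - real n" "real n" x] by simp
        also have "\<dots> \<le> norm (space_deriv (t - real n) (\<Phi> (real n) x)) * V n"
          unfolding V_def by (rule norm_blinfun)
        also have "\<dots> \<le> M * V n"
          by (intro mult_right_mono M bdd) (use t s in \<open>auto simp: V_def\<close>)
        finally show ?thesis by (intro onorm_le) (simp add: mult.commute mult_left_mono)
      qed
    qed (use s in auto)
    also have "\<dots> \<le> (M * V n) * 1"
    proof (intro mult_left_mono)
      have "0 \<le> M" using M[of 0 x] bdd[of 0] by (auto intro: order_trans[OF norm_ge_zero])
      then show "0 \<le> M * V n" by (simp add: V_def)
    qed (use s in auto)
    finally show ?thesis by simp
  qed
  have "summable (\<lambda>n. M * V n)" using summ by (intro summable_mult) (simp add: V_def)
  then have "summable (\<lambda>n. \<Phi> (real (Suc n)) x - \<Phi> (real n) x)"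
    by (rule summable_comparison_test'[where N = 0]) (use step[of 1] in \<open>simp add: add.commute\<close>)
  from summable_LIMSEQ[OF this] obtain l' where "(\<lambda>n. \<Phi> (real n) x - \<Phi> (real 0) x) \<longlonglongrightarrow> l'"
    by (auto simp only: sum_lessThan_telescope[of "\<lambda>n. \<Phi> (real n) x"])
  from tendsto_add[OF this tendsto_const[of "\<Phi> (real 0) x"]]
  obtain l where l: "(\<lambda>n. \<Phi> (real n) x) \<longlonglongrightarrow> l" by auto
  have MV: "(\<lambda>n. M * V n) \<longlonglongrightarrow> 0"
    by (rule summable_LIMSEQ_zero) fact
  have lim: "((\<lambda>t. \<Phi> t x) \<longlongrightarrow> l) at_top"
  proof -
    have fl: "filterlim (\<lambda>t::real. nat \<lfloor>t\<rfloor>) sequentially at_top"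
      by (intro filterlim_compose[OF filterlim_nat_sequentially] filterlim_floor_sequentially)
    have "((\<lambda>t. \<Phi> t x - \<Phi> (real (nat \<lfloor>t\<rfloor>)) x) \<longlongrightarrow> 0) at_top"
    proof (rule Lim_null_comparison[OF _ filterlim_compose[OF MV fl]])
      show "\<forall>\<^sub>F t in at_top. norm (\<Phi> t x - \<Phi> (real (nat \<lfloor>t\<rfloor>)) x) \<le> M * V (nat \<lfloor>t\<rfloor>)"
        using eventually_ge_at_top[of 0]
      proof eventually_elim
        case (elim t)
        then show ?case using step[of "frac t" "nat \<lfloor>t\<rfloor>"]
          by (simp add: frac_def frac_lt_1 less_imp_le) linarith
      qed
    qed
    from tendsto_add[OF this filterlim_compose[OF l fl]] show ?thesis by simp
  qed
  have "omega_limit \<Phi> x = {l}"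
  proof (intro equalityI subsetI)
    fix z assume z: "z \<in> omega_limit \<Phi> x"
    have "dist z l \<le> e" if e: "e > 0" for e
    proof -
      obtain s where s: "\<And>t. t \<ge> s \<Longrightarrow> dist (\<Phi> t x) l < e"
        using tendstoD[OF lim e] by (auto simp: eventually_at_top_linorder)
      have "z \<in> closure (\<Union>t\<in>{max 0 s..}. {\<Phi> t x})"
        using z by (auto simp: omega_limit_def)
      also have "\<dots> \<subseteq> cball l e"
        by (rule closure_minimal) (use s in \<open>auto simp: dist_commute less_imp_le\<close>)
      finally show ?thesis by (simp add: dist_commute)
    qed
    then have "dist z l \<le> 0" by (rule field_le_epsilon[of _ 0, simplified])
    then show "z \<in> {l}" by simp
  next
    fix z assume z: "z \<in> {l}"
    have "l \<in> closure (\<Union>t\<in>{s..}. {\<Phi> t x})" for s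
      by (rule Lim_in_closed_set[OF closed_closure _ _ lim])
        (use closure_subset in \<open>auto simp: eventually_at_top_linorder intro!: exI[of _ s] subsetD[OF closure_subset]\<close>)
    then show "z \<in> omega_limit \<Phi> x" using z by (auto simp: omega_limit_def)
  qed
  then show ?thesis by simp
qed

end

section \<open>Flows that are strongly monotone with respect to a cone\<close>

locale cone_monotone_flow = C1_flow \<Phi> J
  for \<Phi> :: "real \<Rightarrow> 'a::euclidean_space \<Rightarrow> 'a" and J +
  fixes C :: "'a set"
  assumes closed_cone: "closed C"
    and cone_scaleR: "\<And>v l. v \<in> C \<Longrightarrow> l *\<^sub>R v \<in> C"
    and monotone: "strongly_monotone C \<Phi>"
    and space_deriv_cone: "\<And>t x v. t > 0 \<Longrightarrow> v \<in> C \<Longrightarrow> v \<noteq> 0 \<Longrightarrow> blinfun_apply (space_deriv t x) v \<in> interior C"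
begin

lemma flow_diff_interior_cone:
  "y - x \<in> C \<Longrightarrow> y \<noteq> x \<Longrightarrow> t > 0 \<Longrightarrow> \<Phi> t y - \<Phi> t x \<in> interior C"
  using monotone by (auto simp: strongly_monotone_def ordered_def strongly_ordered_def)

lemma flow_diff_cone:
  "y - x \<in> C \<Longrightarrow> y \<noteq> x \<Longrightarrow> t \<ge> 0 \<Longrightarrow> \<Phi> t y - \<Phi> t x \<in> C"
  using flow_diff_interior_cone[of y x t] interior_subset[of C] by (cases "t = 0") auto

definition strongly_unordered :: "'a \<Rightarrow> bool" where
  "strongly_unordered x \<longleftrightarrow> (\<forall>s\<ge>0. \<forall>t\<ge>0. \<Phi> s x - \<Phi> t x \<notin> interior C)"

text \<open>
  A velocity in the cone is moved into the interior by the linearised flow. Then short time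
  increments of the orbit point into the interior as well, and two points of the orbit are
  strongly ordered.
\<close>

lemma velocity_notin_cone:
  assumes x: "strongly_unordered x" and "velocity x \<noteq> 0" "t \<ge> 0"
  shows "velocity (\<Phi> t x) \<notin> C"
proof
  assume V: "velocity (\<Phi> t x) \<in> C"
  define z where "z = \<Phi> (1 + t) x"
  have "velocity z \<in> interior C"
    using space_deriv_cone[OF _ V, of 1 "\<Phi> t x"] assms(2) by (simp add: z_def velocity_flow velocity_zero_iff)
  then obtain e where e: "e > 0" "ball (velocity z) e \<subseteq> interior C"
    using open_contains_ball[of "interior C"] by auto
  have "((\<lambda>s. \<Phi> s z) has_derivative (\<lambda>h. h *\<^sub>R velocity z)) (at 0)"
    using has_vector_derivative_orbit[of z 0] by (simp add: has_vector_derivative_def)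
  then obtain d where d: "d > 0" "\<And>s. norm s < d \<Longrightarrow> norm (\<Phi> s z - z - s *\<^sub>R velocity z) \<le> (e / 2) * norm s"
    using half_gt_zero[OF e(1)] unfolding has_derivative_at_alt by (metis diff_zero flow_zero)
  define s where "s = d / 2"
  have s: "s > 0" "s < d" using d(1) by (auto simp: s_def)
  have "(1/s) *\<^sub>R (\<Phi> s z - z) - velocity z = (1/s) *\<^sub>R (\<Phi> s z - z - s *\<^sub>R velocity z)"
    using s(1) by (simp add: scaleR_diff_right)
  then have "norm ((1/s) *\<^sub>R (\<Phi> s z - z) - velocity z) = norm (\<Phi> s z - z - s *\<^sub>R velocity z) / s"
    using s(1) by (simp only: norm_scaleR) simp
  then have "norm ((1/s) *\<^sub>R (\<Phi> s z - z) - velocity z) \<le> e / 2"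
    using d(2)[of s] s by (simp add: pos_divide_le_eq)
  then have "(1/s) *\<^sub>R (\<Phi> s z - z) \<in> interior C"
    using e by (auto simp: subset_eq dist_norm norm_minus_commute)
  from interior_scaleR_homogeneous[OF cone_scaleR this, of s]
  have "\<Phi> s z - z \<in> interior C" using s(1) by simp
  then have "\<Phi> (s + (1 + t)) x - \<Phi> (1 + t) x \<in> interior C" by (simp add: z_def flow_add)
  moreover have "s + (1 + t) \<ge> 0" "1 + t \<ge> 0" using s(1) assms(3) by auto
  ultimately show False using x unfolding strongly_unordered_def by blast
qed

text \<open>
  If the orbits of \<open>x\<close> and \<open>y\<close> stayed \<open>\<delta>\<close>-close, the velocities \<open>u n\<close> along the orbit of \<open>x\<close>, which are
  outside the cone, would be dominated by the differences \<open>v n\<close> of the orbits, which are inside: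
  the ratio of \<open>u n\<close> to \<open>v n\<close> decays geometrically and \<open>v n\<close> is bounded by \<open>\<delta>\<close>, so the velocities are
  summable. The constant \<open>\<delta>\<close> is the radius within which the nonlinear step of \<open>v n\<close> is within
  the tolerance of \<open>cone_contraction\<close>; it is the same for all orbits in the ball of radius \<open>R\<close>.
\<close>

lemma ordered_companion_separates:
  obtains \<delta> where "0 < \<delta>"
    "\<And>x y. \<lbrakk>\<And>t. t \<ge> 0 \<Longrightarrow> norm (\<Phi> t x) \<le> R; \<And>t. t \<ge> 0 \<Longrightarrow> norm (\<Phi> t y) \<le> R;
       strongly_unordered x; y - x \<in> C; y \<noteq> x; \<not> summable (\<lambda>n. norm (velocity (\<Phi> (real n) x)))\<rbrakk>
      \<Longrightarrow> \<exists>n. \<delta> < norm (\<Phi> (real n) y - \<Phi> (real n) x)"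
proof -
  define \<A> where "\<A> = space_deriv 1 ` cball 0 R"
  have cA: "compact \<A>" unfolding \<A>_def
    by (intro compact_continuous_image continuous_intros compact_cball)
  have posA: "blinfun_apply A v \<in> interior C" if "A \<in> \<A>" "v \<in> C" "v \<noteq> 0" for A v
    using that space_deriv_cone[of 1] by (auto simp: \<A>_def)
  obtain \<theta> \<eta> where \<theta>: "0 < \<theta>" "\<theta> < 1" and \<eta>: "0 < \<eta>" and contr:
    "\<And>A u v v' r s. \<lbrakk>A \<in> \<A>; u \<noteq> 0; blinfun_apply A u \<notin> C; v \<in> C; v \<noteq> 0;
        norm (v' - blinfun_apply A v) \<le> \<eta> * norm v; \<And>s. r \<le> \<bar>s\<bar> \<Longrightarrow> u + s *\<^sub>R v \<in> C; \<theta> * r \<le> \<bar>s\<bar>\<rbrakk>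
      \<Longrightarrow> blinfun_apply A u + s *\<^sub>R v' \<in> C"
    using cone_contraction[OF closed_cone cone_scaleR cA posA] by blast
  obtain c where c: "0 < c" and lower:
    "\<And>A u v r. \<lbrakk>A \<in> \<A>; blinfun_apply A u \<notin> C; 0 \<le> r; \<And>s. r \<le> \<bar>s\<bar> \<Longrightarrow> u + s *\<^sub>R v \<in> C\<rbrakk>
      \<Longrightarrow> c * norm u \<le> r * norm v"
    using cone_comparison_lower_bound[OF closed_cone cone_scaleR cA posA] by blast
  obtain \<delta> where \<delta>: "0 < \<delta>" and lin: 
    "\<And>x y. \<lbrakk>norm x \<le> R; norm y \<le> R; norm (y - x) \<le> \<delta>\<rbrakk>
      \<Longrightarrow> norm (\<Phi> 1 y - \<Phi> 1 x - blinfun_apply (space_deriv 1 x) (y - x)) \<le> \<eta> * norm (y - x)"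
    using flow_step_linearization[OF \<eta>] by blast
  show thesis
  proof (rule that[OF \<delta>], rule ccontr)
    fix x y
    assume bx: "\<And>t. t \<ge> 0 \<Longrightarrow> norm (\<Phi> t x) \<le> R" and b_y: "\<And>t. t \<ge> 0 \<Longrightarrow> norm (\<Phi> t y) \<le> R"
      and x: "strongly_unordered x" and xy: "y - x \<in> C" "y \<noteq> x"
      and ns: "\<not> summable (\<lambda>n. norm (velocity (\<Phi> (real n) x)))"
      and "\<not> (\<exists>n. \<delta> < norm (\<Phi> (real n) y - \<Phi> (real n) x))"
    then have close: "norm (\<Phi> (real n) y - \<Phi> (real n) x) \<le> \<delta>" for n by (auto simp: not_less)
    define u v A where "u n = velocity (\<Phi> (real n) x)" and "v n = \<Phi> (real n) y - \<Phi> (real n) x"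
      and "A n = space_deriv 1 (\<Phi> (real n) x)" for n :: nat
    have V0: "velocity x \<noteq> 0" using ns velocity_zero_iff[of _ x] by auto
    have u: "u n \<notin> C" "u n \<noteq> 0" for n
      using velocity_notin_cone[OF x V0] V0 by (auto simp: u_def velocity_zero_iff)
    have v: "v n \<in> C" "v n \<noteq> 0" "norm (v n) \<le> \<delta>" for n
      using flow_diff_cone[OF xy] flow_inj xy(2) close by (auto simp: v_def)
    have A: "A n \<in> \<A>" "blinfun_apply (A n) (u n) = u (Suc n)" for n
      using bx[of "real n"] velocity_flow[of 1 "real n" x] by (auto simp: A_def \<A>_def u_def)
    have step: "norm (v (Suc n) - blinfun_apply (A n) (v n)) \<le> \<eta> * norm (v n)" for n
      using lin[OF bx[of "real n"] b_y[of "real n"] close] by (simp add: v_def A_def flow_add)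
    \<comment> \<open>The comparison starts at time 1, when the difference has entered the interior of the cone.\<close>
    have "v 1 \<in> interior C" using flow_diff_interior_cone[OF xy, of 1] by (simp add: v_def)
    then obtain r where r: "0 \<le> r" "\<And>s. r \<le> \<bar>s\<bar> \<Longrightarrow> u 1 + s *\<^sub>R v 1 \<in> C"
      using eventually_in_cone[OF cone_scaleR] by blast
    have P: "u (Suc n) + s *\<^sub>R v (Suc n) \<in> C" if "\<theta> ^ n * r \<le> \<bar>s\<bar>" for n s
      using that
    proof (induction n arbitrary: s)
      case 0 then show ?case using r(2) by simp
    next
      case (Suc n)
      have "blinfun_apply (A (Suc n)) (u (Suc n)) + s *\<^sub>R v (Suc (Suc n)) \<in> C"
      proof (rule contr[where v = "v (Suc n)" and r = "\<theta> ^ n * r"])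
        show "blinfun_apply (A (Suc n)) (u (Suc n)) \<notin> C" using A(2) u(1) by simp
        show "\<theta> * (\<theta> ^ n * r) \<le> \<bar>s\<bar>" using Suc.prems by (simp add: mult.assoc)
      qed (use A u v step Suc.IH in auto)
      then show ?case by (simp add: A(2))
    qed
    have "norm (norm (u (Suc n))) \<le> (r * \<delta> / c) * \<theta> ^ n" for n
    proof -
      have "c * norm (u (Suc n)) \<le> (\<theta> ^ n * r) * norm (v (Suc n))"
        using lower[OF A(1)[of "Suc n"] _ _ P[of n]] A(2)[of "Suc n"] u(1) \<theta>(1) r(1) by simp
      also have "\<dots> \<le> (\<theta> ^ n * r) * \<delta>"
        using \<theta>(1) r(1) v(3) by (intro mult_left_mono) auto
      finally show ?thesis using c by (simp add: field_simps)
    qed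
    then have "summable (\<lambda>n. norm (u (Suc n)))"
      using \<theta> by (intro summable_comparison_test'[OF summable_mult[OF summable_geometric[of \<theta>]], of 0 _ "r * \<delta> / c"]) simp_all
    then have "summable (\<lambda>n. norm (u n))" by (simp only: summable_Suc_iff[of "\<lambda>n. norm (u n)"])
    then show False using ns by (simp add: u_def)
  qed
qed

text \<open>
  A superset of the points of \<open>D\<close> that violate the conclusion, chosen so that it is Borel: comparing
  with the open interior of the cone makes the first condition closed, and finite length of the
  orbit stands in for convergence.
\<close>

definition exceptional :: "'a set \<Rightarrow> 'a set" where
  "exceptional D = {x \<in> D. strongly_unordered x \<and> \<not> summable (\<lambda>n. norm (velocity (\<Phi> (real n) x)))}"

lemma exceptional_borel:
  assumes "open D"
  shows "exceptional D \<in> sets borel"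
proof -
  have "closed {x. strongly_unordered x}"
  proof -
    have "{x. strongly_unordered x} = (\<Inter>s\<in>{0..}. \<Inter>t\<in>{0..}. (\<lambda>x. \<Phi> s x - \<Phi> t x) -` (- interior C))"
      by (auto simp: strongly_unordered_def)
    also have "closed \<dots>"
      by (intro closed_INT ballI closed_vimage continuous_intros) auto
    finally show ?thesis .
  qed
  then have 1: "{x. strongly_unordered x} \<in> sets borel" by (rule borel_closed)
  have [measurable]: "(\<lambda>x. norm (velocity (\<Phi> t x))) \<in> borel_measurable borel" for t
    by (intro borel_measurable_continuous_onI continuous_on_norm
        continuous_on_compose2[OF continuous_on_velocity[of UNIV]] continuous_intros) auto
  have "{x. summable (\<lambda>n. norm (velocity (\<Phi> (real n) x)))} =
      {x \<in> space borel. Cauchy (\<lambda>n. \<Sum>i<n. norm (velocity (\<Phi> (real i) x)))}"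
    by (simp add: summable_iff_convergent Cauchy_convergent_iff)
  also have "\<dots> \<in> sets borel"
    by (rule sets_Collect_Cauchy) measurable
  finally have 2: "{x. summable (\<lambda>n. norm (velocity (\<Phi> (real n) x)))} \<in> sets borel" .
  have "exceptional D = D \<inter> {x. strongly_unordered x} - {x. summable (\<lambda>n. norm (velocity (\<Phi> (real n) x)))}"
    by (auto simp: exceptional_def)
  then show ?thesis using 1 2 borel_open[OF assms] by auto
qed

text \<open>
  Ordered exceptional points \<open>x \<noteq> y\<close> are \<open>\<delta>\<close>-separated at some time. On the compact set \<open>P\<close> of
  ordered \<open>\<delta>\<close>-separated pairs, the time-one map produces differences whose distance from the complement
  of the interior is at least some \<open>d > 0\<close>. A perturbation of one of the two points by less than \<open>e\<close>
  moves its image by less than \<open>d\<close> and thus preserves the strong order. If both orbits visit the same balls of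
  radius \<open>e / 2\<close>, the perturbation can be chosen to replace the point on the orbit of \<open>y\<close> by one on the
  orbit of \<open>x\<close>, which contradicts that the latter is strongly unordered. Along a line in
  direction \<open>w\<close> all points are ordered, so the set of visited balls determines the point.
\<close>

lemma exceptional_lines:
  assumes bdd: "\<And>x t. x \<in> D \<Longrightarrow> t \<ge> 0 \<Longrightarrow> norm (\<Phi> t x) \<le> R" and w: "w \<in> C" "w \<noteq> 0"
  obtains N where "\<And>x S. finite S \<Longrightarrow> (\<And>s. s \<in> S \<Longrightarrow> x + s *\<^sub>R w \<in> exceptional D) \<Longrightarrow> card S \<le> N"
proof -
  let ?B = "cball (0::'a) R"
  obtain \<delta> where \<delta>: "0 < \<delta>" and sep:
    "\<And>x y. \<lbrakk>\<And>t. t \<ge> 0 \<Longrightarrow> norm (\<Phi> t x) \<le> R; \<And>t. t \<ge> 0 \<Longrightarrow> norm (\<Phi> t y) \<le> R;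
       strongly_unordered x; y - x \<in> C; y \<noteq> x; \<not> summable (\<lambda>n. norm (velocity (\<Phi> (real n) x)))\<rbrakk>
      \<Longrightarrow> \<exists>n. \<delta> < norm (\<Phi> (real n) y - \<Phi> (real n) x)"
    using ordered_companion_separates by blast
  define P where "P = (?B \<times> ?B) \<inter> ((\<lambda>p. fst p - snd p) -` C \<inter> (\<lambda>p. norm (fst p - snd p)) -` {\<delta>..})"
  have "compact P" unfolding P_def
    by (intro compact_Int_closed compact_Times compact_cball closed_Int closed_vimage closed_cone
        closed_atLeast continuous_intros)
  then have Q: "compact ((\<lambda>p. \<Phi> 1 (fst p) - \<Phi> 1 (snd p)) ` P)"
    by (intro compact_continuous_image continuous_intros)
  have "\<Phi> 1 a - \<Phi> 1 b \<in> interior C" if "(a, b) \<in> P" for a b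
    by (rule flow_diff_interior_cone) (use that \<delta> in \<open>auto simp: P_def\<close>)
  then have disj: "(\<lambda>p. \<Phi> 1 (fst p) - \<Phi> 1 (snd p)) ` P \<inter> - interior C = {}" by auto
  obtain d where d: "d > 0" "\<And>p z. p \<in> P \<Longrightarrow> z \<notin> interior C \<Longrightarrow> d \<le> dist (\<Phi> 1 (fst p) - \<Phi> 1 (snd p)) z"
    using separate_compact_closed[OF Q closed_Compl[OF open_interior] disj] by blast
  have "uniformly_continuous_on ?B (\<Phi> 1)"
    by (intro compact_uniformly_continuous continuous_intros compact_cball)
  then obtain e where e: "e > 0" "\<And>a a'. a \<in> ?B \<Longrightarrow> a' \<in> ?B \<Longrightarrow> dist a' a < e \<Longrightarrow> dist (\<Phi> 1 a') (\<Phi> 1 a) < d"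
    using d(1) unfolding uniformly_continuous_on_def by metis
  obtain I where I: "finite I" "?B \<subseteq> (\<Union>i\<in>I. ball i (e / 2))"
    using compact_cball[of "0::'a" R] half_gt_zero[OF e(1)]
    unfolding compact_eq_totally_bounded by blast
  define visited where "visited x = {i \<in> I. \<exists>t\<ge>0. \<Phi> t x \<in> ball i (e / 2)}" for x
  have distinct: "visited x \<noteq> visited y"
    if x: "x \<in> exceptional D" and y: "y \<in> exceptional D" and xy: "y - x \<in> C" "y \<noteq> x" for x y
  proof
    assume same: "visited x = visited y"
    have bx: "t \<ge> 0 \<Longrightarrow> norm (\<Phi> t x) \<le> R" and b_y: "t \<ge> 0 \<Longrightarrow> norm (\<Phi> t y) \<le> R" for t
      using x y bdd by (auto simp: exceptional_def)
    obtain n where n: "\<delta> < norm (\<Phi> (real n) y - \<Phi> (real n) x)"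
      using sep[OF bx b_y _ xy] x by (auto simp: exceptional_def)
    have "\<Phi> (real n) y \<in> ?B" using b_y by simp
    then obtain i where i: "i \<in> I" "\<Phi> (real n) y \<in> ball i (e / 2)" using I(2) by blast
    then have "i \<in> visited y" unfolding visited_def using of_nat_0_le_iff by blast
    then obtain t where t: "t \<ge> 0" "\<Phi> t x \<in> ball i (e / 2)" using same by (auto simp: visited_def)
    have "dist (\<Phi> t x) (\<Phi> (real n) y) < e"
      using i(2) t(2) by (metis dist_commute dist_triangle_half_r mem_ball)
    then have "dist (\<Phi> 1 (\<Phi> t x)) (\<Phi> 1 (\<Phi> (real n) y)) < d"
      using bx[OF t(1)] b_y[of "real n"] by (intro e(2)) auto
    then have near: "dist (\<Phi> 1 (\<Phi> (real n) y) - \<Phi> 1 (\<Phi> (real n) x)) (\<Phi> 1 (\<Phi> t x) - \<Phi> 1 (\<Phi> (real n) x)) < d"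
      by (simp add: dist_norm norm_minus_commute)
    have "(\<Phi> (real n) y, \<Phi> (real n) x) \<in> P"
      using n bx b_y flow_diff_cone[OF xy, of "real n"] by (auto simp: P_def)
    from d(2)[OF this] near have "\<Phi> 1 (\<Phi> t x) - \<Phi> 1 (\<Phi> (real n) x) \<in> interior C"
      by force
    then have "\<Phi> (1 + t) x - \<Phi> (1 + real n) x \<in> interior C" by (simp add: flow_add)
    moreover have "1 + t \<ge> 0" "1 + real n \<ge> 0" using t(1) by auto
    ultimately show False using x unfolding exceptional_def strongly_unordered_def by blast
  qed
  show thesis
  proof (rule that[of "card (Pow I)"])
    fix x S assume S: "finite S" "\<And>s::real. s \<in> S \<Longrightarrow> x + s *\<^sub>R w \<in> exceptional D"
    have "inj_on (\<lambda>s. visited (x + s *\<^sub>R w)) S"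
    proof (rule inj_onI, rule ccontr)
      fix s s' assume ss: "s \<in> S" "s' \<in> S" "visited (x + s *\<^sub>R w) = visited (x + s' *\<^sub>R w)" "s \<noteq> s'"
      have "(x + s' *\<^sub>R w) - (x + s *\<^sub>R w) = (s' - s) *\<^sub>R w" by (simp add: scaleR_diff_left)
      then have "(x + s' *\<^sub>R w) - (x + s *\<^sub>R w) \<in> C" "x + s' *\<^sub>R w \<noteq> x + s *\<^sub>R w"
        using cone_scaleR[OF w(1), of "s' - s"] ss(4) w(2) by auto
      then show False using distinct S(2) ss by blast
    qed
    then show "card S \<le> card (Pow I)"
      by (rule card_inj_on_le) (use I(1) in \<open>auto simp: visited_def\<close>)
  qed
qed

text \<open>
  If an orbit is not pseudo-ordered, points of it that are strongly ordered coincide. Then \<open>0\<close> is interior to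
  the cone, the cone is the whole space, and any two points are ordered. The orbit would thus be a single
  point, and so would its limit set.
\<close>

lemma exceptional_superset:
  assumes x: "x \<in> D" "\<not> pseudo_ordered_orbit C \<Phi> x" "\<not> is_singleton (omega_limit \<Phi> x)"
    and bdd: "\<And>t. t \<ge> 0 \<Longrightarrow> norm (\<Phi> t x) \<le> R"
  shows "x \<in> exceptional D"
proof -
  have ns: "\<not> summable (\<lambda>n. norm (velocity (\<Phi> (real n) x)))"
    using omega_limit_singleton_if_summable[OF bdd] x(3) by blast
  have nt: "\<exists>t\<ge>0. \<Phi> t x \<noteq> \<Phi> 0 x"
  proof (rule ccontr)
    assume "\<not> ?thesis"
    then have "\<Phi> t x = x" if "t \<ge> 0" for t using that by auto
    then have "(\<Union>t\<in>{s..}. {\<Phi> t x}) = {x}" if "s \<ge> 0" for s using that by force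
    then have "omega_limit \<Phi> x = {x}" by (simp add: omega_limit_def)
    then show False using x(3) by simp
  qed
  then have ns1: "\<not> is_singleton (orbit \<Phi> x)"
    unfolding orbit_def is_singleton_def by (smt (verit) mem_Collect_eq singletonD)
  have incomparable: "\<Phi> s x - \<Phi> t x \<notin> C" if "s \<ge> 0" "t \<ge> 0" "\<Phi> s x \<noteq> \<Phi> t x" for s t
    using x(2) ns1 that unfolding pseudo_ordered_orbit_def ordered_def by blast
  have "strongly_unordered x" unfolding strongly_unordered_def
  proof (intro allI impI notI)
    fix s t :: real assume st: "0 \<le> s" "0 \<le> t" "\<Phi> s x - \<Phi> t x \<in> interior C"
    show False
    proof (cases "\<Phi> s x = \<Phi> t x")
      case True
      then have "C = UNIV" using cone_eq_UNIV_if_zero_interior[OF cone_scaleR] st(3) by simp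
      then show False using nt incomparable by (metis UNIV_I order_refl)
    next
      case False
      then show False using incomparable[OF st(1,2)] st(3) interior_subset[of C] by blast
    qed
  qed
  then show ?thesis using ns x(1) by (simp add: exceptional_def)
qed

end

theorem theoremA:
  fixes C :: "(real ^ 'n) set" and \<Phi> :: "real \<Rightarrow> real ^ 'n \<Rightarrow> real ^ 'n"
    and D :: "(real ^ 'n) set" and k :: nat and \<alpha> :: real
  assumes "k \<ge> 1"
    and "k_solid_cone k C"
    and "0 < \<alpha>" and "\<alpha> \<le> 1"
    and "C1_Hoelder_flow \<alpha> \<Phi>"
    and "strongly_monotone C \<Phi>"
    and "\<And>x t. t > 0 \<Longrightarrow> frechet_derivative (\<Phi> t) (at x) ` (C - {0}) \<subseteq> interior C"
    and "open D" and "bounded D"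
    and "bounded (\<Union>x\<in>D. orbit \<Phi> x)"
  shows "prevalent_in {x \<in> D. x \<in> pseudo_ordered_set C \<Phi> \<or> is_singleton (omega_limit \<Phi> x)} D \<and>
    D - {x \<in> D. x \<in> pseudo_ordered_set C \<Phi> \<or> is_singleton (omega_limit \<Phi> x)} \<in> null_sets lebesgue"
proof -
  obtain J where J: "\<And>p. ((\<lambda>(t, x). \<Phi> t x) has_derivative blinfun_apply (J p)) (at p)"
    "continuous_on UNIV J" and fl: "flow \<Phi>"
    using assms(5) unfolding C1_Hoelder_flow_def C1_Hoelder_def by blast
  interpret C1_flow \<Phi> J by unfold_locales (fact fl J)+
  have cone: "closed C" "\<And>v l. v \<in> C \<Longrightarrow> l *\<^sub>R v \<in> C"
    using assms(2) by (auto simp: k_solid_cone_def k_cone_def)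
  have "frechet_derivative (\<Phi> t) (at x) = blinfun_apply (space_deriv t x)" for t x
    using frechet_derivative_at[OF has_derivative_space] by metis
  then have pos: "blinfun_apply (space_deriv t x) v \<in> interior C" if "t > 0" "v \<in> C" "v \<noteq> 0" for t x v
    using assms(7)[OF that(1), of x] that by auto
  interpret cone_monotone_flow \<Phi> J C
    by unfold_locales (use cone assms(6) pos in auto)
  obtain W where W: "subspace W" "dim W = k" "W \<subseteq> C"
    using assms(2) by (auto simp: k_solid_cone_def k_cone_def)
  then have "\<not> W \<subseteq> {0}" using assms(1) by (metis dim_eq_0 not_one_le_zero)
  then obtain w where w: "w \<in> C" "w \<noteq> 0" using W(3) by blast
  obtain R where "\<And>z. z \<in> (\<Union>x\<in>D. orbit \<Phi> x) \<Longrightarrow> norm z \<le> R"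
    using assms(10) by (auto simp: bounded_iff)
  then have R: "norm (\<Phi> t x) \<le> R" if "x \<in> D" "t \<ge> 0" for x t
    using that by (auto simp: orbit_def)
  obtain N where N: "\<And>x S. finite S \<Longrightarrow> (\<And>s. s \<in> S \<Longrightarrow> x + s *\<^sub>R w \<in> exceptional D) \<Longrightarrow> card S \<le> N"
    using exceptional_lines[OF R w] by blast
  have borel: "exceptional D \<in> sets borel" by (rule exceptional_borel[OF assms(8)])
  have "bounded (exceptional D)"
    by (rule bounded_subset[OF assms(9)]) (auto simp: exceptional_def)
  then have null: "emeasure lborel (exceptional D) = 0"
    by (rule null_set_if_lines_meet_boundedly_often[OF borel _ N])
  let ?good = "{x \<in> D. x \<in> pseudo_ordered_set C \<Phi> \<or> is_singleton (omega_limit \<Phi> x)}"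
  have sub: "D - ?good \<subseteq> exceptional D"
  proof
    fix x assume "x \<in> D - ?good"
    then show "x \<in> exceptional D"
      by (intro exceptional_superset[where R = R] R) (auto simp: pseudo_ordered_set_def)
  qed
  have "prevalent_in ?good D"
    unfolding prevalent_in_def shy_def using shy_Borel_if_lborel_null[OF borel null] sub by blast
  moreover have "exceptional D \<in> null_sets lebesgue"
    using borel null by (intro null_sets_completionI) (auto simp: null_sets_def)
  then have "D - ?good \<in> null_sets lebesgue"
    using sub by (rule null_sets_completion_subset[rotated])
  ultimately show ?thesis by blast
qed

end
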